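(* Let $(z^j)_{j\ge0}$ be generated by the relaxed Peaceman-Rachford iteration with relaxation parameters $(\lambda_j)_{j\ge0}\subset(0,1]$, let $z^\ast$ be a fixed point of $T_{\mathrm{PRS}}$, and let $x^\ast=\mathbf{prox}_{\gamma g}(z^\ast)$. Let $\beta,\mu>0$ and suppose that $g$ (respectively $f$) is differentiable with $(1/\beta)$-Lipschitz gradient and that $f$ (respectively $g$) is $\mu$-strongly convex. For $\lambda\in[0,1]$ let $$C(\lambda):=\Big(1-\frac{4\lambda}3\min\{\gamma\mu,\ \beta/\gamma,\ 1-\lambda\}\Big)^{1/2}.$$ Then for all $k\ge0$, $\|z^{k+1}-z^\ast\|\le C(\lambda_k)\|z^k-z^\ast\|$.
   Context: $\mathcal H$ is a real Hilbert space; $f,g:\mathcal H\to(-\infty,\infty]$ are closed, proper, convex, and there is $x\in\mathcal H$ with $0\in\partial f(x)+\partial g(x)$. Fix $\gamma>0$. $\mathbf{prox}_{\gamma f}(x)=\arg\min_y f(y)+\frac1{2\gamma}\|y-x\|^2$, $\mathbf{refl}_{\gamma f}=2\,\mathbf{prox}_{\gamma f}-I$, $T_{\mathrm{PRS}}=\mathbf{refl}_{\gamma f}\circ\mathbf{refl}_{\gamma g}$. Differentiable means Fréchet differentiable on $\mathcal H$. Relaxed Peaceman-Rachford iteration: $z^0\in\mathcal H$ arbitrary, $z^{k+1}=(1-\lambda_k)z^k+\lambda_kT_{\mathrm{PRS}}z^k$. *)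

theory Defs
  imports "HOL-Analysis.Analysis"
begin

definition ereal_epigraph :: "('a \<Rightarrow> ereal) \<Rightarrow> ('a \<times> real) set" where
  "ereal_epigraph f = {(x, r). f x \<le> ereal r}"

definition closed_proper_convex :: "('a::real_normed_vector \<Rightarrow> ereal) \<Rightarrow> bool" where
  "closed_proper_convex f \<longleftrightarrow>
     closed (ereal_epigraph f) \<and>
     (\<forall>x. f x \<noteq> -\<infinity>) \<and> (\<exists>x. f x \<noteq> \<infinity>) \<and>
     convex (ereal_epigraph f)"

text \<open>
  Only used for functions that never take the value \<open>-\<infinity>\<close>, so no sum below has the
  form \<open>\<infinity> - \<infinity>\<close>. With \<open>0 < t < 1\<close> the right-hand side is \<open>\<infinity>\<close> as soon as one of
  \<open>f x\<close>, \<open>f y\<close> is.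
\<close>
definition strongly_convex :: "real \<Rightarrow> ('a::real_normed_vector \<Rightarrow> ereal) \<Rightarrow> bool" where
  "strongly_convex \<mu> f \<longleftrightarrow>
     (\<forall>x y. \<forall>t\<in>{0<..<1}.
        f (t *\<^sub>R x + (1 - t) *\<^sub>R y) + ereal (\<mu> / 2 * t * (1 - t) * (norm (x - y))\<^sup>2)
          \<le> ereal t * f x + ereal (1 - t) * f y)"

definition subdifferential :: "('a::real_inner \<Rightarrow> ereal) \<Rightarrow> 'a \<Rightarrow> 'a set" where
  "subdifferential f x = {u. \<forall>y. f x + ereal (inner u (y - x)) \<le> f y}"

text \<open>
  Frechet differentiability on the whole space forces an extended-valued function to be
  finite everywhere; finiteness is required separately because \<open>real_of_ereal\<close> sends
  infinite values to \<open>0\<close>.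
\<close>
definition has_lipschitz_gradient :: "real \<Rightarrow> ('a::real_inner \<Rightarrow> ereal) \<Rightarrow> bool" where
  "has_lipschitz_gradient L f \<longleftrightarrow>
     (\<forall>x. \<bar>f x\<bar> \<noteq> \<infinity>) \<and>
     (\<exists>G. (\<forall>x. GDERIV (\<lambda>y. real_of_ereal (f y)) x :> G x) \<and> L-lipschitz_on UNIV G)"

definition prox :: "real \<Rightarrow> ('a::real_normed_vector \<Rightarrow> ereal) \<Rightarrow> 'a \<Rightarrow> 'a" where
  "prox \<gamma> f x = (ARG_MIN (\<lambda>y. f y + ereal (1 / (2 * \<gamma>) * (norm (y - x))\<^sup>2)) y. True)"

definition refl_prox :: "real \<Rightarrow> ('a::real_normed_vector \<Rightarrow> ereal) \<Rightarrow> 'a \<Rightarrow> 'a" where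
  "refl_prox \<gamma> f x = 2 *\<^sub>R prox \<gamma> f x - x"

definition T_PRS ::
  "real \<Rightarrow> ('a::real_normed_vector \<Rightarrow> ereal) \<Rightarrow> ('a \<Rightarrow> ereal) \<Rightarrow> 'a \<Rightarrow> 'a" where
  "T_PRS \<gamma> f g = refl_prox \<gamma> f \<circ> refl_prox \<gamma> g"

definition relaxed_PRS_iteration ::
  "real \<Rightarrow> ('a::real_normed_vector \<Rightarrow> ereal) \<Rightarrow> ('a \<Rightarrow> ereal) \<Rightarrow> (nat \<Rightarrow> real) \<Rightarrow> (nat \<Rightarrow> 'a) \<Rightarrow> bool"
  where
  "relaxed_PRS_iteration \<gamma> f g \<Lambda> z \<longleftrightarrow>
     (\<forall>k. z (Suc k) = (1 - \<Lambda> k) *\<^sub>R z k + \<Lambda> k *\<^sub>R T_PRS \<gamma> f g (z k))"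

definition PRS_rate :: "real \<Rightarrow> real \<Rightarrow> real \<Rightarrow> real \<Rightarrow> real" where
  "PRS_rate \<gamma> \<beta> \<mu> l = sqrt (1 - 4 * l / 3 * Min {\<gamma> * \<mu>, \<beta> / \<gamma>, 1 - l})"

end

theory Submission
  imports Defs
begin

text \<open>
  Let \<open>a\<close>, \<open>b\<close> be the displacements from the solution of the two proximal points in one
  step, and \<open>p\<close>, \<open>q\<close> those of the associated subgradients of \<open>g\<close> and \<open>f\<close>. Then
  \<open>z - z* = a + \<gamma> p\<close> and \<open>a - b = \<gamma> (p + q)\<close>, so that the squared distance to \<open>z*\<close> drops by
  exactly \<open>4 \<lambda> (1 - \<lambda>) \<parallel>a - b\<parallel>\<^sup>2 + 4 \<lambda> \<gamma> (\<langle>p, a\<rangle> + \<langle>q, b\<rangle>)\<close>. Strong convexity bounds one of the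
  inner products below by \<open>\<mu>\<close> times a squared primal displacement, and cocoercivity of the
  Lipschitz gradient bounds the other one by \<open>\<beta>\<close> times a squared dual displacement. Since
  \<open>z - z* = (a - b) + \<gamma> p + b = (a - b) - \<gamma> q + a\<close>, in either case the three squares together
  dominate \<open>\<parallel>z - z*\<parallel>\<^sup>2 / 3\<close>.
\<close>

text \<open>Used to let \<open>t\<close> tend to 0 from the right once a convexity inequality along
  a segment has been divided by \<open>t\<close>.\<close>

lemma le_of_le_add_small_multiple:
  fixes A B C :: real
  assumes "\<And>t. 0 < t \<Longrightarrow> t < 1 \<Longrightarrow> A \<le> C + t * B"
  shows "A \<le> C"
proof (rule tendsto_lowerbound)
  show "((\<lambda>t. C + t * B) \<longlongrightarrow> C) (at_right 0)"
    by (auto intro!: tendsto_eq_intros)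
  show "\<forall>\<^sub>F t in at_right 0. A \<le> C + t * B"
    using eventually_at_right_less[of 0] eventually_at_right_real[of 0 1]
    by (auto elim!: eventually_mono simp: assms)
qed simp

subsection \<open>Proximal points\<close>

lemma closed_proper_convex_convex:
  assumes "closed_proper_convex f" "f x \<le> ereal r" "f y \<le> ereal s" "0 \<le> t" "t \<le> 1"
  shows "f ((1 - t) *\<^sub>R x + t *\<^sub>R y) \<le> ereal ((1 - t) * r + t * s)"
proof -
  have "convex (ereal_epigraph f)"
    using assms(1) by (simp add: closed_proper_convex_def)
  moreover have "(x, r) \<in> ereal_epigraph f" "(y, s) \<in> ereal_epigraph f"
    using assms(2,3) by (simp_all add: ereal_epigraph_def)
  ultimately have "(1 - t) *\<^sub>R (x, r) + t *\<^sub>R (y, s) \<in> ereal_epigraph f"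
    using assms(4,5) by (intro convexD) simp_all
  then show ?thesis
    by (simp add: ereal_epigraph_def)
qed

lemma closed_proper_convex_lsc:
  assumes "closed_proper_convex f" "X \<longlonglongrightarrow> x" "R \<longlonglongrightarrow> r" "\<And>n::nat. f (X n) \<le> ereal (R n)"
  shows "f x \<le> ereal r"
proof -
  have "closed (ereal_epigraph f)"
    using assms(1) by (simp add: closed_proper_convex_def)
  moreover have "(X n, R n) \<in> ereal_epigraph f" for n
    using assms(4) by (simp add: ereal_epigraph_def)
  ultimately have "(x, r) \<in> ereal_epigraph f"
    using tendsto_Pair[OF assms(2,3)] by (rule closed_sequentially)
  then show ?thesis
    by (simp add: ereal_epigraph_def)
qed

lemma closed_proper_convex_finite_point:
  assumes "closed_proper_convex f"
  obtains x r where "f x = ereal r"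
proof -
  obtain x where "f x \<noteq> \<infinity>" "f x \<noteq> -\<infinity>"
    using assms by (auto simp: closed_proper_convex_def)
  then show ?thesis
    using that by (cases "f x") auto
qed

text \<open>Lower semicontinuity keeps \<open>f\<close> above \<open>r - 1\<close> on a ball around
  a point with finite value \<open>r\<close>; convexity along rays from that point carries the bound
  outside the ball at a loss linear in the distance. Quantifying over real bounds \<open>s\<close>
  of \<open>f y\<close> keeps infinite values out of the arithmetic.\<close>

lemma closed_proper_convex_linear_minorant:
  fixes f :: "'a::real_inner \<Rightarrow> ereal"
  assumes f: "closed_proper_convex f"
  obtains x0 m c where "c \<ge> 0" "\<And>y s. f y \<le> ereal s \<Longrightarrow> m - c * norm (y - x0) \<le> s"
proof -
  obtain x0 r where r: "f x0 = ereal r"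
    using closed_proper_convex_finite_point[OF f] .
  have "\<exists>d>0. \<forall>y. norm (y - x0) < d \<longrightarrow> ereal (r - 1) < f y"
  proof (rule ccontr)
    assume "\<not> ?thesis"
    then have "\<forall>n. \<exists>y. norm (y - x0) < 1 / real (Suc n) \<and> f y \<le> ereal (r - 1)"
      by (metis not_less of_nat_0_less_iff zero_less_Suc zero_less_divide_1_iff)
    then obtain X where X: "\<And>n. norm (X n - x0) < 1 / real (Suc n)" "\<And>n. f (X n) \<le> ereal (r - 1)"
      by metis
    have "(\<lambda>n. X n - x0) \<longlonglongrightarrow> 0"
      by (rule Lim_null_comparison[OF _ LIMSEQ_inverse_real_of_nat])
         (use X in \<open>auto intro!: always_eventually simp: inverse_eq_divide less_imp_le simp del: of_nat_Suc\<close>)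
    then have "X \<longlonglongrightarrow> x0"
      by (simp add: LIM_zero_iff)
    from closed_proper_convex_lsc[OF f this tendsto_const X(2)] r show False
      by simp
  qed
  then obtain d where d: "d > 0" "\<And>y. norm (y - x0) < d \<Longrightarrow> ereal (r - 1) < f y"
    by blast
  have "r - 1 - 2 / d * norm (y - x0) \<le> s" if y: "f y \<le> ereal s" for y s
  proof (cases "norm (y - x0) < d")
    case True
    then have "ereal (r - 1) < ereal s"
      using d(2) y by (meson less_le_trans)
    moreover have "0 \<le> 2 / d * norm (y - x0)"
      using d(1) by simp
    ultimately show ?thesis
      by simp
  next
    case False
    \<comment> \<open>This puts the point at parameter \<open>t\<close> of the segment at distance
      \<open>d / 2\<close> from \<open>x0\<close>, inside the ball.\<close>
    define t where "t = d / (2 * norm (y - x0))"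
    have n: "norm (y - x0) > 0"
      using False d(1) by linarith
    have t: "0 < t" "t \<le> 1"
      using False d(1) n by (auto simp: t_def field_simps)
    have "(1 - t) *\<^sub>R x0 + t *\<^sub>R y - x0 = t *\<^sub>R (y - x0)"
      by (simp add: algebra_simps)
    then have "norm ((1 - t) *\<^sub>R x0 + t *\<^sub>R y - x0) = d / 2"
      using n d(1) by (simp add: t_def)
    then have "ereal (r - 1) < f ((1 - t) *\<^sub>R x0 + t *\<^sub>R y)"
      using d by simp
    also have "\<dots> \<le> ereal ((1 - t) * r + t * s)"
      using t r y by (intro closed_proper_convex_convex[OF f]) auto
    finally have "t * (r - s) < 1"
      by (simp add: algebra_simps)
    then have "r - s < 1 / t"
      using t by (simp add: field_simps)
    also have "1 / t = 2 / d * norm (y - x0)"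
      using n d by (simp add: t_def field_simps)
    finally show ?thesis
      by simp
  qed
  then show ?thesis
    using d(1) by (intro that[of "2 / d" "r - 1" x0]) auto
qed

text \<open>The quadratic term absorbs the linear decay of the minorant, by completing the square in
  \<open>norm (y - x)\<close>.\<close>

lemma prox_objective_bounded_below:
  fixes f :: "'a::real_inner \<Rightarrow> ereal"
  assumes f: "closed_proper_convex f" and "\<gamma> > 0"
  obtains m where "\<And>y s. f y \<le> ereal s \<Longrightarrow> m \<le> s + 1 / (2 * \<gamma>) * (norm (y - x))\<^sup>2"
proof -
  obtain x0 m c where c: "c \<ge> 0" "\<And>y s. f y \<le> ereal s \<Longrightarrow> m - c * norm (y - x0) \<le> s"
    using closed_proper_convex_linear_minorant[OF f] by metis
  have "m - c * norm (x - x0) - \<gamma> * c\<^sup>2 / 2 \<le> s + 1 / (2 * \<gamma>) * (norm (y - x))\<^sup>2"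
    if "f y \<le> ereal s" for y s
  proof -
    have "norm (y - x0) \<le> norm (y - x) + norm (x - x0)"
      by (metis diff_add_cancel add_diff_eq norm_triangle_ineq)
    then have "c * norm (y - x0) \<le> c * norm (y - x) + c * norm (x - x0)"
      using c(1) by (metis distrib_left mult_left_mono)
    moreover have "0 \<le> 1 / (2 * \<gamma>) * (norm (y - x) - \<gamma> * c)\<^sup>2"
      using \<open>\<gamma> > 0\<close> by simp
    then have "c * norm (y - x) \<le> 1 / (2 * \<gamma>) * (norm (y - x))\<^sup>2 + \<gamma> * c\<^sup>2 / 2"
      using \<open>\<gamma> > 0\<close> by (simp add: power2_eq_square field_simps)
    ultimately show ?thesis
      using c(2)[OF that] by linarith
  qed
  then show ?thesis
    using that by blast
qed

text \<open>A form of the parallelogram law; the last term is what forces minimizing sequences to be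
  Cauchy.\<close>

lemma norm_midpoint_sq:
  fixes a b x :: "'a::real_inner"
  shows "(norm ((1 - 1/2) *\<^sub>R a + (1/2) *\<^sub>R b - x))\<^sup>2
    = (norm (a - x))\<^sup>2 / 2 + (norm (b - x))\<^sup>2 / 2 - (norm (a - b))\<^sup>2 / 4"
  by (simp add: power2_norm_eq_inner inner_simps inner_commute field_simps)

text \<open>Direct method: a minimizing sequence is Cauchy by the parallelogram law, completeness
  gives a limit, and the closed epigraph shows that the limit is a minimizer.\<close>

lemma prox_objective_attains_min:
  fixes f :: "'a::{real_inner, complete_space} \<Rightarrow> ereal"
  assumes f: "closed_proper_convex f" and \<gamma>: "\<gamma> > 0"
  shows "\<exists>p. \<forall>y. f p + ereal (1 / (2 * \<gamma>) * (norm (p - x))\<^sup>2)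
    \<le> f y + ereal (1 / (2 * \<gamma>) * (norm (y - x))\<^sup>2)"
proof -
  define h where "h y = 1 / (2 * \<gamma>) * (norm (y - x))\<^sup>2" for y
  \<comment> \<open>The real upper bounds of the objective: nonempty and bounded below, so the
    infimum can be taken in the reals.\<close>
  define V where "V = {s + h y |y s. f y \<le> ereal s}"
  define I where "I = Inf V"
  obtain m where m: "\<And>y s. f y \<le> ereal s \<Longrightarrow> m \<le> s + h y"
    using prox_objective_bounded_below[OF assms, of x] unfolding h_def by metis
  have bdd: "bdd_below V"
    using m by (auto simp: V_def bdd_below_def)
  have ne: "V \<noteq> {}"
    using closed_proper_convex_finite_point[OF f] unfolding V_def
    by (metis (mono_tags, lifting) empty_Collect_eq order_refl)
  have I_le: "I \<le> s + h y" if "f y \<le> ereal s" for y s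
    unfolding I_def by (rule cInf_lower[OF _ bdd]) (use that in \<open>auto simp: V_def\<close>)
  have "\<exists>y s. f y \<le> ereal s \<and> s + h y < I + inverse (real (Suc n))" for n
    using cInf_lessD[OF ne, of "I + inverse (real (Suc n))"] by (auto simp: I_def V_def)
  then obtain X R where X: "\<And>n. f (X n) \<le> ereal (R n)"
    and XR: "\<And>n. R n + h (X n) < I + inverse (real (Suc n))"
    by metis
  \<comment> \<open>The objective at the midpoint is at least \<open>I\<close>, while both endpoints
    exceed \<open>I\<close> by less than a reciprocal.\<close>
  have dist: "(norm (X i - X j))\<^sup>2 \<le> 4 * \<gamma> * (inverse (real (Suc i)) + inverse (real (Suc j)))"
    for i j
  proof -
    let ?y = "(1 - 1/2) *\<^sub>R X i + (1/2) *\<^sub>R X j"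
    have "f ?y \<le> ereal ((1 - 1/2) * R i + 1/2 * R j)"
      by (intro closed_proper_convex_convex[OF f] X) auto
    from I_le[OF this] have "2 * I \<le> R i + R j + 2 * h ?y"
      by simp
    also have "2 * h ?y = h (X i) + h (X j) - (norm (X i - X j))\<^sup>2 / (4 * \<gamma>)"
      unfolding h_def norm_midpoint_sq using \<gamma> by (simp add: field_simps)
    finally have "(norm (X i - X j))\<^sup>2 / (4 * \<gamma>) \<le> inverse (real (Suc i)) + inverse (real (Suc j))"
      using XR[of i] XR[of j] by linarith
    then show ?thesis
      using \<gamma> by (simp add: field_simps)
  qed
  have "Cauchy X"
  proof (rule CauchyI)
    fix e :: real assume e: "e > 0"
    then have "e\<^sup>2 / (8 * \<gamma>) > 0"
      using \<gamma> by simp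
    then obtain N where N: "inverse (real (Suc N)) < e\<^sup>2 / (8 * \<gamma>)"
      using reals_Archimedean by blast
    have "norm (X i - X j) < e" if "i \<ge> N" "j \<ge> N" for i j
    proof (rule power2_less_imp_less)
      have "inverse (real (Suc i)) \<le> inverse (real (Suc N))"
           "inverse (real (Suc j)) \<le> inverse (real (Suc N))"
        using that by (auto intro!: le_imp_inverse_le)
      then have "inverse (real (Suc i)) + inverse (real (Suc j)) < e\<^sup>2 / (8 * \<gamma>) + e\<^sup>2 / (8 * \<gamma>)"
        using N by linarith
      then have "4 * \<gamma> * (inverse (real (Suc i)) + inverse (real (Suc j))) < e\<^sup>2"
        using \<gamma> by (simp add: pos_less_divide_eq mult.commute flip: add_divide_distrib)
      then show "(norm (X i - X j))\<^sup>2 < e\<^sup>2"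
        using dist[of i j] by linarith
    qed (use e in simp)
    then show "\<exists>M. \<forall>m\<ge>M. \<forall>n\<ge>M. norm (X m - X n) < e"
      by blast
  qed
  then obtain p where p: "X \<longlonglongrightarrow> p"
    using Cauchy_convergent convergent_def by blast
  \<comment> \<open>Convergence of \<open>R\<close> is not known, so \<open>R n\<close> is replaced
    by a larger bound that does converge.\<close>
  have "(\<lambda>n. I + inverse (real (Suc n)) - h (X n)) \<longlonglongrightarrow> I + 0 - h p"
    unfolding h_def by (intro tendsto_intros p LIMSEQ_inverse_real_of_nat)
  moreover have "f (X n) \<le> ereal (I + inverse (real (Suc n)) - h (X n))" for n
    using X[of n] XR[of n] by (elim order_trans) simp
  ultimately have fp: "f p \<le> ereal (I + 0 - h p)"
    using closed_proper_convex_lsc[OF f p] by blast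
  have "f p + ereal (h p) \<le> f y + ereal (h y)" for y
  proof (cases "f y")
    case (real s)
    have "f p + ereal (h p) \<le> ereal (I + 0 - h p) + ereal (h p)"
      using fp by (rule add_right_mono)
    also have "\<dots> \<le> f y + ereal (h y)"
      using I_le[of y s] real by simp
    finally show ?thesis .
  next
    case MInf
    then show ?thesis
      using f by (auto simp: closed_proper_convex_def)
  qed simp
  then show ?thesis
    unfolding h_def by blast
qed

text \<open>\<open>prox\<close> is defined by choice, so minimality passes to it from the existence
  of some minimizer.\<close>

lemma prox_minimizes:
  fixes f :: "'a::{real_inner, complete_space} \<Rightarrow> ereal"
  assumes "closed_proper_convex f" "\<gamma> > 0"
  shows "f (prox \<gamma> f x) + ereal (1 / (2 * \<gamma>) * (norm (prox \<gamma> f x - x))\<^sup>2)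
    \<le> f y + ereal (1 / (2 * \<gamma>) * (norm (y - x))\<^sup>2)"
proof -
  let ?F = "\<lambda>y. f y + ereal (1 / (2 * \<gamma>) * (norm (y - x))\<^sup>2)"
  have "\<exists>p. is_arg_min ?F (\<lambda>_. True) p"
    using prox_objective_attains_min[OF assms, of x] by (auto simp: is_arg_min_linorder)
  then have "is_arg_min ?F (\<lambda>_. True) (prox \<gamma> f x)"
    unfolding prox_def arg_min_def by (rule someI_ex)
  then show ?thesis
    by (auto simp: is_arg_min_linorder)
qed

section \<open>Subgradients at proximal points\<close>

lemma subdifferential_finite:
  assumes "closed_proper_convex f" "u \<in> subdifferential f x"
  obtains r where "f x = ereal r"
proof -
  obtain y s where "f y = ereal s"
    using closed_proper_convex_finite_point[OF assms(1)] .
  moreover have "f x + ereal (inner u (y - x)) \<le> f y"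
    using assms(2) by (simp add: subdifferential_def)
  moreover have "f x \<noteq> -\<infinity>"
    using assms(1) by (simp add: closed_proper_convex_def)
  ultimately show ?thesis
    using that by (cases "f x") auto
qed

text \<open>First-order optimality: compare the minimizer \<open>p\<close> with points of the
  segment from \<open>p\<close> to \<open>y\<close>, expand the square, divide by \<open>t\<close>
  and let \<open>t\<close> tend to 0.\<close>

lemma prox_subgradient:
  fixes f :: "'a::{real_inner, complete_space} \<Rightarrow> ereal"
  assumes f: "closed_proper_convex f" and \<gamma>: "\<gamma> > 0"
  shows "(1 / \<gamma>) *\<^sub>R (x - prox \<gamma> f x) \<in> subdifferential f (prox \<gamma> f x)"
proof -
  define p where "p = prox \<gamma> f x"
  have min: "f p + ereal (1 / (2 * \<gamma>) * (norm (p - x))\<^sup>2)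
      \<le> f y + ereal (1 / (2 * \<gamma>) * (norm (y - x))\<^sup>2)" for y
    unfolding p_def by (rule prox_minimizes[OF assms])
  obtain x0 r0 where "f x0 = ereal r0"
    using closed_proper_convex_finite_point[OF f] .
  moreover have "f p \<noteq> -\<infinity>"
    using f by (simp add: closed_proper_convex_def)
  ultimately obtain r where r: "f p = ereal r"
    using min[of x0] by (cases "f p") auto
  have "f p + ereal (inner ((1 / \<gamma>) *\<^sub>R (x - p)) (y - p)) \<le> f y" for y
  proof (cases "f y")
    case (real s)
    have "r + inner (x - p) (y - p) / \<gamma> \<le> s"
    proof (rule le_of_le_add_small_multiple)
      fix t :: real assume t: "0 < t" "t < 1"
      let ?y = "(1 - t) *\<^sub>R p + t *\<^sub>R y"
      have "f ?y \<le> ereal ((1 - t) * r + t * s)"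
        using t r real by (intro closed_proper_convex_convex[OF f]) auto
      then have "f ?y + ereal (1 / (2 * \<gamma>) * (norm (?y - x))\<^sup>2)
          \<le> ereal ((1 - t) * r + t * s) + ereal (1 / (2 * \<gamma>) * (norm (?y - x))\<^sup>2)"
        by (rule add_right_mono)
      from order_trans[OF min this] have
        "r + 1 / (2 * \<gamma>) * (norm (p - x))\<^sup>2 \<le> (1 - t) * r + t * s + 1 / (2 * \<gamma>) * (norm (?y - x))\<^sup>2"
        by (simp add: r)
      also have "?y - x = (p - x) + t *\<^sub>R (y - p)"
        by (simp add: algebra_simps)
      also have "(norm \<dots>)\<^sup>2
          = (norm (p - x))\<^sup>2 - 2 * t * inner (x - p) (y - p) + t\<^sup>2 * (norm (y - p))\<^sup>2"
        by (simp add: power2_norm_eq_inner inner_simps inner_commute power2_eq_square[of t] algebra_simps)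
      finally have "t * (r + inner (x - p) (y - p) / \<gamma>)
          \<le> t * (s + t * ((norm (y - p))\<^sup>2 / (2 * \<gamma>)))"
        using \<gamma> by (simp add: field_simps power2_eq_square)
      then show "r + inner (x - p) (y - p) / \<gamma> \<le> s + t * ((norm (y - p))\<^sup>2 / (2 * \<gamma>))"
        using t by simp
    qed
    then show ?thesis
      by (simp add: r real)
  next
    case MInf
    then show ?thesis
      using f by (auto simp: closed_proper_convex_def)
  qed simp
  then show ?thesis
    by (simp add: subdifferential_def flip: p_def)
qed

subsection \<open>Monotonicity of the subdifferential\<close>

text \<open>The subgradient inequality and strong convexity are combined at a point of the segment
  near \<open>x\<close>. After division by \<open>t\<close>, the factor \<open>1 - t\<close> leaves
  an error that vanishes with \<open>t\<close>.\<close>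

lemma strongly_convex_subgradient_ineq:
  fixes f :: "'a::real_inner \<Rightarrow> ereal"
  assumes "strongly_convex \<mu> f" "u \<in> subdifferential f x" "f x = ereal r" "f y = ereal s"
  shows "r + inner u (y - x) + \<mu> / 2 * (norm (y - x))\<^sup>2 \<le> s"
proof (rule le_of_le_add_small_multiple)
  fix t :: real assume t: "0 < t" "t < 1"
  let ?w = "t *\<^sub>R y + (1 - t) *\<^sub>R x"
  have "f x + ereal (inner u (?w - x)) \<le> f ?w"
    using assms(2) by (simp add: subdifferential_def)
  then have "f x + ereal (inner u (?w - x)) + ereal (\<mu> / 2 * t * (1 - t) * (norm (y - x))\<^sup>2)
      \<le> f ?w + ereal (\<mu> / 2 * t * (1 - t) * (norm (y - x))\<^sup>2)"
    by (rule add_right_mono)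
  also have "\<dots> \<le> ereal t * f y + ereal (1 - t) * f x"
    using assms(1) t by (auto simp: strongly_convex_def)
  finally have "r + inner u (?w - x) + \<mu> / 2 * t * (1 - t) * (norm (y - x))\<^sup>2 \<le> t * s + (1 - t) * r"
    by (simp add: assms)
  also have "?w - x = t *\<^sub>R (y - x)"
    by (simp add: algebra_simps)
  finally have "t * (r + inner u (y - x) + \<mu> / 2 * (norm (y - x))\<^sup>2)
      \<le> t * (s + t * (\<mu> / 2 * (norm (y - x))\<^sup>2))"
    by (simp add: algebra_simps diff_divide_distrib)
  then show "r + inner u (y - x) + \<mu> / 2 * (norm (y - x))\<^sup>2 \<le> s + t * (\<mu> / 2 * (norm (y - x))\<^sup>2)"
    using t by simp
qed

text \<open>Add the strengthened subgradient inequalities at \<open>x\<close> and at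
  \<open>y\<close>; the function values cancel.\<close>

lemma strongly_convex_strongly_monotone:
  fixes f :: "'a::real_inner \<Rightarrow> ereal"
  assumes "closed_proper_convex f" "strongly_convex \<mu> f"
    and u: "u \<in> subdifferential f x" and v: "v \<in> subdifferential f y"
  shows "\<mu> * (norm (x - y))\<^sup>2 \<le> inner (u - v) (x - y)"
proof -
  obtain r s where rs: "f x = ereal r" "f y = ereal s"
    using subdifferential_finite[OF assms(1) u] subdifferential_finite[OF assms(1) v] by metis
  have "r + inner u (y - x) + \<mu> / 2 * (norm (x - y))\<^sup>2 \<le> s"
       "s + inner v (x - y) + \<mu> / 2 * (norm (x - y))\<^sup>2 \<le> r"
    using strongly_convex_subgradient_ineq[OF assms(2) u rs]
      strongly_convex_subgradient_ineq[OF assms(2) v rs(2,1)]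
    by (simp_all add: norm_minus_commute)
  then show ?thesis
    by (simp add: inner_diff_left inner_diff_right)
qed

section \<open>Descent lemma and cocoercivity of a Lipschitz gradient\<close>

lemma GDERIV_line:
  assumes "GDERIV F (x + t *\<^sub>R h) :> d"
  shows "((\<lambda>t. F (x + t *\<^sub>R h)) has_real_derivative inner d h) (at t)"
proof -
  have "((\<lambda>t. x + t *\<^sub>R h) has_derivative (\<lambda>s. s *\<^sub>R h)) (at t)"
    by (auto intro!: derivative_eq_intros)
  moreover have "(F has_derivative (\<lambda>v. inner v d)) (at (x + t *\<^sub>R h))"
    using assms by (simp add: gderiv_def)
  ultimately have "((\<lambda>t. F (x + t *\<^sub>R h)) has_derivative (\<lambda>s. inner (s *\<^sub>R h) d)) (at t)"
    by (rule has_derivative_compose)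
  then show ?thesis
    by (simp add: has_field_derivative_def inner_commute mult_commute_abs)
qed

text \<open>Along the segment, \<open>F\<close> minus its proposed majorant has derivative at most
  0, by Cauchy-Schwarz and the Lipschitz bound.\<close>

lemma descent_lemma:
  fixes G :: "'a::real_inner \<Rightarrow> 'a"
  assumes G: "\<And>x. GDERIV F x :> G x" and L: "L-lipschitz_on UNIV G"
  shows "F y \<le> F x + inner (G x) (y - x) + L / 2 * (norm (y - x))\<^sup>2"
proof -
  define h where "h = y - x"
  define \<phi> where "\<phi> t = F (x + t *\<^sub>R h) - t * inner (G x) h - L / 2 * (norm h)\<^sup>2 * t\<^sup>2" for t
  have "\<phi> 1 \<le> \<phi> 0"
  proof (rule DERIV_nonpos_imp_nonincreasing[of 0 1 \<phi>])
    fix t :: real assume t: "0 \<le> t" "t \<le> 1"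
    have "(\<phi> has_real_derivative
        inner (G (x + t *\<^sub>R h)) h - inner (G x) h - L * (norm h)\<^sup>2 * t) (at t)"
      unfolding \<phi>_def by (auto intro!: derivative_eq_intros GDERIV_line G)
    moreover have "inner (G (x + t *\<^sub>R h) - G x) h \<le> L * (norm h)\<^sup>2 * t"
    proof -
      have "inner (G (x + t *\<^sub>R h) - G x) h \<le> norm (G (x + t *\<^sub>R h) - G x) * norm h"
        by (rule norm_cauchy_schwarz)
      also have "norm (G (x + t *\<^sub>R h) - G x) \<le> L * norm (t *\<^sub>R h)"
        using lipschitz_onD[OF L, of "x + t *\<^sub>R h" x] by (simp add: dist_norm)
      finally show ?thesis
        using t by (simp add: mult_right_mono power2_eq_square mult_ac)
    qed
    ultimately show "\<exists>d. (\<phi> has_real_derivative d) (at t) \<and> d \<le> 0"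
      by (auto simp: inner_diff_left)
  qed simp
  then show ?thesis
    by (simp add: \<phi>_def h_def)
qed

text \<open>Subtracting the affine minorant leaves a minimum at \<open>x\<close>; the vanishing
  derivative in direction \<open>u - d\<close> says that this direction has norm 0.\<close>

lemma subgradient_unique_differentiable:
  fixes F :: "'a::real_inner \<Rightarrow> real"
  assumes "GDERIV F x :> d" and u: "\<And>y. F x + inner u (y - x) \<le> F y"
  shows "u = d"
proof -
  define h where "h = u - d"
  define \<phi> where "\<phi> t = F (x + t *\<^sub>R h) - t * inner u h" for t
  have "(\<phi> has_real_derivative inner d h - inner u h) (at 0)"
    unfolding \<phi>_def using assms(1) by (auto intro!: derivative_eq_intros GDERIV_line)
  moreover have "\<phi> 0 \<le> \<phi> t" for t
    using u[of "x + t *\<^sub>R h"] by (simp add: \<phi>_def)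
  ultimately have "inner d h - inner u h = 0"
    by (intro DERIV_local_min[of \<phi> _ 0 1]) auto
  then have "inner h h = 0"
    by (simp add: h_def inner_diff_left)
  then show ?thesis
    by (simp add: h_def)
qed

text \<open>
  The gap between \<open>F\<close> and its affine minorant at \<open>x\<close> is estimated by comparing the minorant
  with the quadratic majorant at \<open>y\<close>, both evaluated at \<open>y - \<beta> (G y - G x)\<close>.
\<close>
lemma lipschitz_gradient_gap:
  fixes G :: "'a::real_inner \<Rightarrow> 'a"
  assumes "\<beta> > 0" and G: "\<And>x. GDERIV F x :> G x" and L: "(1 / \<beta>)-lipschitz_on UNIV G"
    and x: "\<And>y. F x + inner (G x) (y - x) \<le> F y"
  shows "F x + inner (G x) (y - x) + \<beta> / 2 * (norm (G y - G x))\<^sup>2 \<le> F y"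
proof -
  define d where "d = G y - G x"
  have Gy: "inner (G y) d = inner (G x) d + inner d d"
    by (simp add: d_def inner_diff_left)
  have "F x + inner (G x) (y - \<beta> *\<^sub>R d - x) \<le> F (y - \<beta> *\<^sub>R d)"
    by (rule x)
  also have "\<dots> \<le> F y + inner (G y) (- \<beta> *\<^sub>R d) + 1 / \<beta> / 2 * (norm (- \<beta> *\<^sub>R d))\<^sup>2"
    using descent_lemma[OF G L, of "y - \<beta> *\<^sub>R d" y] by simp
  also have "1 / \<beta> / 2 * (norm (- \<beta> *\<^sub>R d))\<^sup>2 = \<beta> / 2 * inner d d"
    using \<open>\<beta> > 0\<close> by (simp add: power_mult_distrib power2_eq_square dot_square_norm)
  finally show ?thesis
    unfolding d_def[symmetric] power2_norm_eq_inner
    by (simp add: inner_diff_right Gy algebra_simps)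
qed

text \<open>The Baillon-Haddad inequality. Both subgradients coincide with gradients and supply the
  affine minorants for the gap estimate, which is added to its copy with \<open>x\<close> and
  \<open>y\<close> exchanged.\<close>

lemma lipschitz_gradient_cocoercive:
  fixes f :: "'a::real_inner \<Rightarrow> ereal"
  assumes "\<beta> > 0" and f: "has_lipschitz_gradient (1 / \<beta>) f"
    and u: "u \<in> subdifferential f x" and v: "v \<in> subdifferential f y"
  shows "\<beta> * (norm (u - v))\<^sup>2 \<le> inner (u - v) (x - y)"
proof -
  define F where "F x = real_of_ereal (f x)" for x
  have fF: "f x = ereal (F x)" for x
    using f by (simp add: F_def has_lipschitz_gradient_def ereal_real')
  obtain G where G: "\<And>x. GDERIV F x :> G x" "(1 / \<beta>)-lipschitz_on UNIV G"
    using f by (auto simp: has_lipschitz_gradient_def F_def[abs_def])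
  have sub: "F x + inner u (w - x) \<le> F w" "F y + inner v (w - y) \<le> F w" for w
    using u v by (auto simp: subdifferential_def fF)
  have eq: "u = G x" "v = G y"
    using subgradient_unique_differentiable[OF G(1) sub(1)]
      subgradient_unique_differentiable[OF G(1) sub(2)] by simp_all
  have "F x + inner u (y - x) + \<beta> / 2 * (norm (u - v))\<^sup>2 \<le> F y"
       "F y + inner v (x - y) + \<beta> / 2 * (norm (u - v))\<^sup>2 \<le> F x"
    using lipschitz_gradient_gap[OF \<open>\<beta> > 0\<close> G sub(1)[unfolded eq], of y]
      lipschitz_gradient_gap[OF \<open>\<beta> > 0\<close> G sub(2)[unfolded eq], of x]
    by (simp_all add: eq norm_minus_commute[of "G x"])
  then show ?thesis
    by (simp add: inner_diff_left inner_diff_right)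
qed

subsection \<open>One relaxed Peaceman-Rachford step\<close>

text \<open>The two sides differ by the sum of the three squared pairwise distances. This is the
  source of the 3 in \<open>PRS_rate\<close>.\<close>

lemma norm_add3_sq_le:
  fixes a b c :: "'a::real_inner"
  shows "(norm (a + b + c))\<^sup>2 \<le> 3 * ((norm a)\<^sup>2 + (norm b)\<^sup>2 + (norm c)\<^sup>2)"
proof -
  have "0 \<le> (norm (a - b))\<^sup>2 + (norm (b - c))\<^sup>2 + (norm (a - c))\<^sup>2"
    by simp
  then show ?thesis
    by (simp add: power2_norm_eq_inner inner_simps inner_commute algebra_simps)
qed

text \<open>The hypothesis turns the inner product of \<open>a + \<gamma> *\<^sub>R p\<close> with
  \<open>a - b\<close> into
  \<open>(norm (a - b))\<^sup>2 + \<gamma> * (inner p a + inner q b)\<close>; the rest is expansion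
  of the square.\<close>

lemma relaxed_step_norm:
  fixes a b p q :: "'a::real_inner"
  assumes "a - b = \<gamma> *\<^sub>R (p + q)"
  shows "(norm (a + \<gamma> *\<^sub>R p + (2 * l) *\<^sub>R (b - a)))\<^sup>2
    = (norm (a + \<gamma> *\<^sub>R p))\<^sup>2
      - 4 * l * ((1 - l) * (norm (a - b))\<^sup>2 + \<gamma> * (inner p a + inner q b))"
proof -
  have b: "b = a - \<gamma> *\<^sub>R (p + q)"
    using assms by (simp add: algebra_simps)
  show ?thesis
    unfolding b by (simp add: power2_norm_eq_inner inner_simps inner_commute algebra_simps)
qed

lemma relaxed_step_contracts:
  fixes a b p q :: "'a::real_inner"
  assumes ab: "a - b = \<gamma> *\<^sub>R (p + q)" and pos: "\<gamma> > 0" "\<beta> > 0" "\<mu> > 0"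
    and l: "0 < l" "l \<le> 1"
    and mono: "\<beta> * (norm p)\<^sup>2 \<le> inner p a \<and> \<mu> * (norm b)\<^sup>2 \<le> inner q b \<or>
      \<beta> * (norm q)\<^sup>2 \<le> inner q b \<and> \<mu> * (norm a)\<^sup>2 \<le> inner p a"
  shows "norm (a + \<gamma> *\<^sub>R p + (2 * l) *\<^sub>R (b - a)) \<le> PRS_rate \<gamma> \<beta> \<mu> l * norm (a + \<gamma> *\<^sub>R p)"
proof -
  define Z where "Z = a + \<gamma> *\<^sub>R p"
  define m where "m = Min {\<gamma> * \<mu>, \<beta> / \<gamma>, 1 - l}"
  have m: "m \<le> \<gamma> * \<mu>" "m \<le> \<beta> / \<gamma>" "m \<le> 1 - l" "0 \<le> m"
    using pos l by (auto simp: m_def)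
  \<comment> \<open>Common to both cases: \<open>s\<close> is the dual displacement controlled by
    cocoercivity, \<open>w\<close> the primal one controlled by strong monotonicity.\<close>
  have bound: "m * (norm Z)\<^sup>2 / 3 \<le> (1 - l) * (norm (a - b))\<^sup>2 + \<gamma> * (i + j)"
    if "Z = (a - b) + \<gamma> *\<^sub>R s + w" "\<beta> * (norm s)\<^sup>2 \<le> i" "\<mu> * (norm w)\<^sup>2 \<le> j" for s w i j
  proof -
    have "m * (norm Z)\<^sup>2 / 3 \<le> m * ((norm (a - b))\<^sup>2 + (norm (\<gamma> *\<^sub>R s))\<^sup>2 + (norm w)\<^sup>2)"
      using mult_left_mono[OF norm_add3_sq_le m(4), of "a - b" "\<gamma> *\<^sub>R s" w]
      unfolding that(1) mult.left_commute[of m] by simp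
    also have "\<dots> \<le> (1 - l) * (norm (a - b))\<^sup>2 + \<beta> / \<gamma> * (norm (\<gamma> *\<^sub>R s))\<^sup>2 + \<gamma> * \<mu> * (norm w)\<^sup>2"
      unfolding distrib_left by (intro add_mono mult_right_mono m) auto
    also have "\<beta> / \<gamma> * (norm (\<gamma> *\<^sub>R s))\<^sup>2 = \<gamma> * (\<beta> * (norm s)\<^sup>2)"
      using pos by (simp add: power_mult_distrib power2_eq_square)
    also have "(1 - l) * (norm (a - b))\<^sup>2 + \<gamma> * (\<beta> * (norm s)\<^sup>2) + \<gamma> * \<mu> * (norm w)\<^sup>2
        \<le> (1 - l) * (norm (a - b))\<^sup>2 + \<gamma> * i + \<gamma> * j"
      using that pos by (intro add_mono) (auto simp: mult.assoc)
    finally show ?thesis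
      by (simp add: algebra_simps)
  qed
  have drop: "m * (norm Z)\<^sup>2 / 3 \<le> (1 - l) * (norm (a - b))\<^sup>2 + \<gamma> * (inner p a + inner q b)"
    using mono
  proof (elim disjE conjE)
    assume "\<beta> * (norm p)\<^sup>2 \<le> inner p a" "\<mu> * (norm b)\<^sup>2 \<le> inner q b"
    then show ?thesis
      by (intro bound) (auto simp: Z_def)
  next
    assume "\<beta> * (norm q)\<^sup>2 \<le> inner q b" "\<mu> * (norm a)\<^sup>2 \<le> inner p a"
    \<comment> \<open>The sign of \<open>q\<close> is harmless, since \<open>bound\<close> sees
      \<open>s\<close> only through its norm.\<close>
    moreover have "Z = (a - b) + \<gamma> *\<^sub>R (- q) + a"
      by (simp add: Z_def ab algebra_simps)
    ultimately show ?thesis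
      using bound[of "- q" a "inner q b" "inner p a"] by (simp add: add.commute)
  qed
  have "(norm (Z + (2 * l) *\<^sub>R (b - a)))\<^sup>2
      = (norm Z)\<^sup>2 - 4 * l * ((1 - l) * (norm (a - b))\<^sup>2 + \<gamma> * (inner p a + inner q b))"
    unfolding Z_def by (rule relaxed_step_norm[OF ab])
  also have "\<dots> \<le> (norm Z)\<^sup>2 - 4 * l * (m * (norm Z)\<^sup>2 / 3)"
    using drop l by (intro diff_left_mono mult_left_mono) auto
  also have "\<dots> = (1 - 4 * l / 3 * m) * (norm Z)\<^sup>2"
    by (simp add: algebra_simps)
  finally have "norm (Z + (2 * l) *\<^sub>R (b - a)) \<le> sqrt ((1 - 4 * l / 3 * m) * (norm Z)\<^sup>2)"
    by (rule real_le_rsqrt)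
  then show ?thesis
    by (simp add: Z_def PRS_rate_def m_def real_sqrt_mult)
qed

theorem theorem7:
  fixes f g :: "'a::{real_inner, complete_space} \<Rightarrow> ereal"
    and z :: "nat \<Rightarrow> 'a" and zs xs :: 'a
    and \<Lambda> :: "nat \<Rightarrow> real" and \<gamma> \<beta> \<mu> :: real
  assumes "closed_proper_convex f" and "closed_proper_convex g"
    and "\<exists>x. 0 \<in> subdifferential f x + subdifferential g x"
    and "\<gamma> > 0" and "\<beta> > 0" and "\<mu> > 0"
    and "\<And>j. \<Lambda> j \<in> {0<..1}"
    and "relaxed_PRS_iteration \<gamma> f g \<Lambda> z"
    and "T_PRS \<gamma> f g zs = zs"
    and "xs = prox \<gamma> g zs"
    and "(has_lipschitz_gradient (1 / \<beta>) g \<and> strongly_convex \<mu> f) \<or>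
         (has_lipschitz_gradient (1 / \<beta>) f \<and> strongly_convex \<mu> g)"
  shows "\<forall>k. norm (z (Suc k) - zs) \<le> PRS_rate \<gamma> \<beta> \<mu> (\<Lambda> k) * norm (z k - zs)"
proof
  fix k
  define x where "x = prox \<gamma> g (z k)"
  define w where "w = 2 *\<^sub>R x - z k"
  define y where "y = prox \<gamma> f w"
  define ws where "ws = 2 *\<^sub>R xs - zs"
  define p where "p = (1 / \<gamma>) *\<^sub>R (z k - x)"
  define ps where "ps = (1 / \<gamma>) *\<^sub>R (zs - xs)"
  define q where "q = (1 / \<gamma>) *\<^sub>R (w - y)"
  define qs where "qs = (1 / \<gamma>) *\<^sub>R (ws - xs)"
  \<comment> \<open>The fixed-point equation makes both proximal points at the solution equal to
    \<open>xs\<close>.\<close>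
  have "2 *\<^sub>R prox \<gamma> f ws = 2 *\<^sub>R xs"
    using assms(9,10) by (simp add: T_PRS_def refl_prox_def ws_def algebra_simps)
  then have ys: "prox \<gamma> f ws = xs"
    by simp
  have sub: "p \<in> subdifferential g x" "ps \<in> subdifferential g xs"
      "q \<in> subdifferential f y" "qs \<in> subdifferential f xs"
    using prox_subgradient[OF assms(2,4), of "z k"] prox_subgradient[OF assms(2,4), of zs]
      prox_subgradient[OF assms(1,4), of w] prox_subgradient[OF assms(1,4), of ws]
    by (simp_all add: p_def ps_def q_def qs_def x_def y_def assms(10) ys flip: assms(10))
  have eqs: "\<gamma> *\<^sub>R p = z k - x" "\<gamma> *\<^sub>R ps = zs - xs" "\<gamma> *\<^sub>R q = w - y" "\<gamma> *\<^sub>R qs = ws - xs"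
    using \<open>\<gamma> > 0\<close> by (simp_all add: p_def ps_def q_def qs_def)
  \<comment> \<open>By \<open>eqs\<close>, the sum of \<open>\<gamma> *\<^sub>R p\<close> and
    \<open>\<gamma> *\<^sub>R q\<close> is \<open>x - y\<close>, and the starred sum is 0.\<close>
  have ab: "(x - xs) - (y - xs) = \<gamma> *\<^sub>R ((p - ps) + (q - qs))"
    unfolding scaleR_add_right scaleR_diff_right eqs w_def ws_def
    by (simp add: algebra_simps scaleR_2)
  have mono: "\<beta> * (norm (p - ps))\<^sup>2 \<le> inner (p - ps) (x - xs) \<and>
        \<mu> * (norm (y - xs))\<^sup>2 \<le> inner (q - qs) (y - xs) \<or>
      \<beta> * (norm (q - qs))\<^sup>2 \<le> inner (q - qs) (y - xs) \<and>
        \<mu> * (norm (x - xs))\<^sup>2 \<le> inner (p - ps) (x - xs)"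
    using assms(11) lipschitz_gradient_cocoercive[OF \<open>\<beta> > 0\<close>] sub
      strongly_convex_strongly_monotone[OF assms(1)] strongly_convex_strongly_monotone[OF assms(2)]
    by blast
  have Z: "(x - xs) + \<gamma> *\<^sub>R (p - ps) = z k - zs"
    unfolding scaleR_diff_right eqs by simp
  \<comment> \<open>The second reflection is \<open>2 *\<^sub>R y - w\<close>, so a relaxed step
    moves \<open>z k\<close> along \<open>y - x\<close> only.\<close>
  have T: "T_PRS \<gamma> f g (z k) = z k + 2 *\<^sub>R (y - x)"
    by (simp add: T_PRS_def refl_prox_def y_def w_def x_def algebra_simps)
  have "z (Suc k) = (1 - \<Lambda> k) *\<^sub>R z k + \<Lambda> k *\<^sub>R T_PRS \<gamma> f g (z k)"
    using assms(8) by (simp add: relaxed_PRS_iteration_def)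
  then have "z (Suc k) = z k + (2 * \<Lambda> k) *\<^sub>R (y - x)"
    unfolding T by (simp add: algebra_simps)
  then have step: "z (Suc k) - zs = z k - zs + (2 * \<Lambda> k) *\<^sub>R ((y - xs) - (x - xs))"
    by simp
  show "norm (z (Suc k) - zs) \<le> PRS_rate \<gamma> \<beta> \<mu> (\<Lambda> k) * norm (z k - zs)"
    using relaxed_step_contracts[OF ab assms(4,5,6) _ _ mono, of "\<Lambda> k"] assms(7)[of k]
    unfolding Z step by simp
qed

end
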